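(* Let $f_2,f_3,\ldots$ be indeterminates, let $f(z)=z+f_2z^2/2!+f_3z^3/3!+\cdots$ and $F(z)=\exp f(z)$, and let $F_n(x)=[z^n]\,F(z)^x$ for $n\ge 0$. Put $y=n/x$, let $s$ be the formal power series in $y$ with zero constant term satisfying $s\,f'(s)=y$, and let $$\widetilde F_n(x)=\frac{F(s)^x}{n!}\left(\frac{n}{es}\right)^n .$$ Then the ratio $F_n(x)/\widetilde F_n(x)$, regarded as a formal power series in $x^{-1}$ whose coefficients are polynomials in $n$ (in the sense explained in the context), can be written as a formal power series $$\frac{F_n(x)}{\widetilde F_n(x)}=\sum_{i,j\ge 0}c_{ij}\,y^i x^{-j},\qquad y=n/x,$$ where the coefficients $c_{ij}$ are polynomials in $f_2,f_3,\ldots$ (with rational coefficients) that do not depend on $n$ or $x$. Equivalently, if the ratio is written as $\sum_{i,j\ge 0}a_{ij}n^ix^{-j}$, then $a_{ij}=0$ whenever $i>j$ (and $c_{ij}=a_{i(i+j)}$).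
   Context: $[z^n]$ denotes the coefficient of $z^n$, and $F(z)^x=\exp(x f(z))$. Each $F_n(x)$ is a polynomial in $x$ of degree $n$. Precise meaning of the ratio as a formal series. Let $A=\mathbb{Q}[f_2,f_3,\ldots]$; all computations take place in $A[n][[x^{-1}]]$, with $n$ treated as an indeterminate. (1) For each $k\ge 0$ there is a polynomial $\varphi_k(n)\in A[n]$ of degree at most $2k$ in $n$, namely $$\varphi_k(n)=\sum \frac{n^{\underline{k+k_2+k_3+\cdots}}}{2!^{k_2}\,k_2!\,3!^{k_3}\,k_3!\cdots}\,f_2^{k_2}f_3^{k_3}\cdots,$$ summed over all nonnegative integers $k_2,k_3,\ldots$ with $k_2+2k_3+3k_4+\cdots=k$, where $n^{\underline m}=n(n-1)\cdots(n-m+1)$. For all integers $n\ge 0$ one has $F_n(x)=\frac{x^n}{n!}\sum_{k\ge 0}\varphi_k(n)x^{-k}$. So $F_n(x)/(x^n/n!)$ is identified with $\sum_{k\ge0}\varphi_k(n)x^{-k}\in A[n][[x^{-1}]]$. (2) The series $s$ in $y$ satisfies $s/y=1-f_2y+\cdots\in A[[y]]$, with constant term $1$. Since $x=n/y$, $\widetilde F_n(x)$ is identified with $$\widetilde F_n(x)=\frac{x^n}{n!}\;\exp\bigl(n\,(s/y)(1+f_2s/2!+f_3s^2/3!+\cdots)-n\bigr)\,(s/y)^{-n},$$ where $(s/y)^{-n}=\exp(-n\ln(s/y))$. After substituting $y=n x^{-1}$, the factor multiplying $x^n/n!$ is an element of $A[n][[x^{-1}]]$ with constant term $1$ (as a series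 in $x^{-1}$). The ratio $F_n(x)/\widetilde F_n(x)$ is the quotient of the series in (1) by the series in (2), an element of $A[n][[x^{-1}]]$. *)

theory Defs
  imports
    "HOL-Library.Poly_Mapping"
    "HOL-Computational_Algebra.Polynomial"
    "HOL-Computational_Algebra.Formal_Power_Series"
begin

unbundle fps_syntax

text \<open>
  The ring \<open>A = Q[f\<^sub>2, f\<^sub>3, \<dots>]\<close>: an element maps monomials (finitely supported exponent
  vectors) to rational coefficients. Position \<open>i\<close> of an exponent vector belongs to
  \<open>f\<^bsub>i+2\<^esub>\<close>, so that there are no indeterminates besides \<open>f\<^sub>2, f\<^sub>3, \<dots>\<close>.
\<close>

type_synonym coeff_ring = "(nat \<Rightarrow>\<^sub>0 nat) \<Rightarrow>\<^sub>0 rat"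

definition rat_const :: "rat \<Rightarrow> coeff_ring" where
  "rat_const r = Poly_Mapping.single 0 r"

text \<open>Only meaningful for \<open>i \<ge> 2\<close>.\<close>

definition indet :: "nat \<Rightarrow> coeff_ring" where
  "indet i = Poly_Mapping.single (Poly_Mapping.single (i - 2) 1) 1"

definition map_fps :: "('a \<Rightarrow> 'b) \<Rightarrow> 'a fps \<Rightarrow> 'b fps" where
  "map_fps h g = Abs_fps (\<lambda>k. h (g $ k))"

text \<open>
  The type \<^typ>\<open>coeff_ring poly\<close> serves both as \<open>A[x]\<close> (for the polynomials \<open>F\<^sub>n(x)\<close>)
  and as \<open>A[n]\<close> (for the coefficients of the ratio). The series argument of
  \<^typ>\<open>coeff_ring poly fps\<close> is \<open>z\<close>, \<open>y\<close> or \<open>x\<^sup>-\<^sup>1\<close>, as indicated below.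
\<close>

definition lift_const :: "coeff_ring fps \<Rightarrow> coeff_ring poly fps" where
  "lift_const = map_fps (\<lambda>a. [:a:])"

definition poly_var :: "coeff_ring poly fps" where
  "poly_var = fps_const [:0, 1:]"

text \<open>
  The library's \<^const>\<open>inverse\<close>, \<^const>\<open>fps_exp\<close> and \<^const>\<open>fps_ln\<close> need coefficients in a
  field. The exponential of a series with zero constant term and the logarithm of a
  series with constant term 1 are obtained by composing with the image of the rational
  series \<open>exp X\<close> and \<open>ln (1 + X)\<close>.
\<close>

definition formal_exp :: "coeff_ring poly fps \<Rightarrow> coeff_ring poly fps" where
  "formal_exp g = map_fps (\<lambda>r. [:rat_const r:]) (fps_exp 1) oo g"

definition formal_ln :: "coeff_ring fps \<Rightarrow> coeff_ring fps" where
  "formal_ln g = map_fps rat_const (fps_ln 1) oo (g - 1)"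

definition f_series :: "coeff_ring fps" where
  "f_series = Abs_fps (\<lambda>k. if k = 0 then 0 else if k = 1 then 1
                            else rat_const (1 / fact k) * indet k)"

text \<open>\<open>F\<^sub>n(x) = [z\<^sup>n] exp (x f(z))\<close>, an element of \<open>A[x]\<close>.\<close>

definition F_poly :: "nat \<Rightarrow> coeff_ring poly" where
  "F_poly n = formal_exp (poly_var * lift_const f_series) $ n"

definition falling_poly :: "nat \<Rightarrow> coeff_ring poly" where
  "falling_poly m = (\<Prod>i<m. [:- of_nat i, 1:])"

text \<open>The families \<open>(k\<^sub>2, k\<^sub>3, \<dots>)\<close> with \<open>k\<^sub>2 + 2 k\<^sub>3 + 3 k\<^sub>4 + \<dots> = k\<close>.\<close>

definition index_families :: "nat \<Rightarrow> (nat \<Rightarrow>\<^sub>0 nat) set" where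
  "index_families k = {\<kappa>. Poly_Mapping.keys \<kappa> \<subseteq> {2..} \<and>
     (\<Sum>i\<in>Poly_Mapping.keys \<kappa>. (i - 1) * Poly_Mapping.lookup \<kappa> i) = k}"

definition phi :: "nat \<Rightarrow> coeff_ring poly" where
  "phi k = (\<Sum>\<kappa>\<in>index_families k.
     smult (\<Prod>i\<in>Poly_Mapping.keys \<kappa>.
              rat_const (1 / (fact i ^ Poly_Mapping.lookup \<kappa> i * fact (Poly_Mapping.lookup \<kappa> i)))
              * indet i ^ Poly_Mapping.lookup \<kappa> i)
           (falling_poly (k + (\<Sum>i\<in>Poly_Mapping.keys \<kappa>. Poly_Mapping.lookup \<kappa> i))))"

text \<open>
  \<open>F\<^sub>n(x) / (x\<^sup>n / n!)\<close> as an element of \<open>A[n][[x\<^sup>-\<^sup>1]]\<close>. That \<open>F\<^sub>n(x) = x\<^sup>n / n! * \<Sum>\<^sub>k \<phi>\<^sub>k(n) x\<^sup>-\<^sup>k\<close> for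
  every natural number \<open>n\<close>, which links this series to \<^const>\<open>F_poly\<close>, is the first
  conjunct of the main theorem.
\<close>

definition F_factor :: "coeff_ring poly fps" where
  "F_factor = Abs_fps phi"

text \<open>The power series \<open>s\<close> in \<open>y\<close> with \<open>s f'(s) = y\<close>.\<close>

definition s_series :: "coeff_ring fps" where
  "s_series = (THE s. s $ 0 = 0 \<and> s * (fps_deriv f_series oo s) = fps_X)"

definition s_over_y :: "coeff_ring fps" where
  "s_over_y = fps_shift 1 s_series"

text \<open>
  The factor multiplying \<open>x\<^sup>n / n!\<close> in
  \<open>F(s)\<^sup>x / n! * (n / (e s))\<^sup>n = x\<^sup>n / n! * exp (n f(s) / y - n) * (s / y)\<^sup>-\<^sup>n\<close>, first as a
  series in \<open>y\<close>, then as an element of \<open>A[n][[x\<^sup>-\<^sup>1]]\<close> after substituting \<open>y = n x\<^sup>-\<^sup>1\<close>.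
  Here \<open>f(s) / y = (s / y) (1 + f\<^sub>2 s / 2! + \<dots>)\<close>.
\<close>

definition F_tilde_factor_y :: "coeff_ring poly fps" where
  "F_tilde_factor_y =
     formal_exp (poly_var * lift_const (s_over_y * (fps_shift 1 f_series oo s_series)) - poly_var)
     * formal_exp (- (poly_var * lift_const (formal_ln s_over_y)))"

definition y_series :: "coeff_ring poly fps" where
  "y_series = poly_var * fps_X"

definition F_tilde_factor :: "coeff_ring poly fps" where
  "F_tilde_factor = F_tilde_factor_y oo y_series"

definition F_ratio :: "coeff_ring poly fps" where
  "F_ratio = F_factor * fps_right_inverse F_tilde_factor 1"

lemma F_ratio_times_F_tilde_factor: "F_ratio * F_tilde_factor = F_factor"
proof -
  have "rat_const 1 = 1"
    by (simp add: rat_const_def)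
  then have "F_tilde_factor $ 0 = 1"
    by (simp add: F_tilde_factor_def F_tilde_factor_y_def formal_exp_def map_fps_def pCons_one)
  then have "F_tilde_factor * fps_right_inverse F_tilde_factor 1 = 1"
    by (intro fps_right_inverse) simp
  then show ?thesis
    by (simp add: F_ratio_def mult.assoc mult.commute)
qed

lemma finite_index_families: "finite (index_families k)"
proof -
  have bound: "Poly_Mapping.lookup \<kappa> i \<le> k \<and> (Poly_Mapping.lookup \<kappa> i \<noteq> 0 \<longrightarrow> i \<le> k + 1)"
    if "\<kappa> \<in> index_families k" for \<kappa> i
  proof (cases "i \<in> Poly_Mapping.keys \<kappa>")
    case True
    have "(i - 1) * Poly_Mapping.lookup \<kappa> i
            \<le> (\<Sum>i\<in>Poly_Mapping.keys \<kappa>. (i - 1) * Poly_Mapping.lookup \<kappa> i)"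
      using True by (intro member_le_sum) auto
    then have le: "(i - 1) * Poly_Mapping.lookup \<kappa> i \<le> k"
      using that by (simp add: index_families_def)
    have "2 \<le> i"
      using that True unfolding index_families_def by blast
    moreover have "1 \<le> Poly_Mapping.lookup \<kappa> i"
      using True by (simp add: in_keys_iff)
    ultimately have "1 * Poly_Mapping.lookup \<kappa> i \<le> (i - 1) * Poly_Mapping.lookup \<kappa> i"
      and "(i - 1) * 1 \<le> (i - 1) * Poly_Mapping.lookup \<kappa> i"
      by (intro mult_le_mono; simp)+
    with le show ?thesis by linarith
  qed (simp add: in_keys_iff)
  have "Poly_Mapping.lookup ` index_families k
          \<subseteq> {g. \<forall>i. (i \<in> {..k + 1} \<longrightarrow> g i \<in> {..k}) \<and> (i \<notin> {..k + 1} \<longrightarrow> g i = 0)}"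
    using bound by fastforce
  then have "finite (Poly_Mapping.lookup ` index_families k)"
    by (rule finite_subset) (intro finite_set_of_finite_funs; simp)
  then show ?thesis
    by (rule finite_imageD) (simp add: inj_on_def poly_mapping_eqI)
qed

end

(*
  With y = n/x and u = 1/x, a series in u whose u^j-coefficient has degree at most j in n is a
  power series in y and u, and its value at u = 0 collects the coefficients of n^j u^j.
  The series Phi(n) = F_n(x) / (x^n/n!) satisfies
    Phi(n) = sum_j f_{j+1}/j! (n-1)(n-2)...(n-j) u^j Phi(n-j-1).
  Dividing by exp(n g(y)), the factor of the approximation, turns this into a recurrence for the
  ratio R. Its kernels are power series in y and u because exp((n-m) g((n-m)u) - n g(nu)) is; at
  u = 0 that exponential is exp(-m (y g)') = (s/y)^m. Hence at u = 0 the kernels add up to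
  (s/y) f'(s) = 1, and comparing coefficients of u^j shows inductively that the
  coefficient a_j of R satisfies deg (a_j(n) - a_j(n-1)) < j, so that a_j has degree at most j.
*)
theory Submission
  imports Defs
begin

lemma map_fps_nth [simp]: "map_fps h g $ k = h (g $ k)"
  by (simp add: map_fps_def)

lemma lift_const_nth [simp]: "lift_const g $ k = [:g $ k:]"
  by (simp add: lift_const_def)

lemma rat_const_0 [simp]: "rat_const 0 = 0"
  by (simp add: rat_const_def)

lemma rat_const_1 [simp]: "rat_const 1 = 1"
  by (simp add: rat_const_def)

lemma rat_const_mult: "rat_const (a * b) = rat_const a * rat_const b"
  by (simp add: rat_const_def mult_single)

lemma rat_const_add: "rat_const (a + b) = rat_const a + rat_const b"
  by (simp add: rat_const_def single_add)

lemma rat_const_of_nat [simp]: "rat_const (of_nat n) = of_nat n"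
  by (induction n) (simp_all add: rat_const_add)

lemma of_nat_mult_rat_const: "of_nat n * rat_const r = rat_const (of_nat n * r)"
  by (simp add: rat_const_mult)

section \<open>Formal exponential and logarithm\<close>

lemma fps_linear_ode_unique:
  fixes u v :: "'a :: {idom, ring_char_0} fps"
  assumes "fps_deriv u = a * u" "fps_deriv v = a * v" "u $ 0 = v $ 0"
  shows "u = v"
proof (rule fps_ext)
  fix n
  show "u $ n = v $ n"
  proof (induction n rule: less_induct)
    case (less n)
    show ?case
    proof (cases n)
      case (Suc m)
      have "of_nat (Suc m) * u $ Suc m = (a * u) $ m"
        by (simp flip: assms(1))
      also have "\<dots> = (a * v) $ m"
        unfolding fps_mult_nth using less Suc by (intro sum.cong) auto
      also have "\<dots> = of_nat (Suc m) * v $ Suc m"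
        by (simp flip: assms(2))
      finally show ?thesis
        using Suc by (simp del: of_nat_Suc)
    qed (use assms in simp)
  qed
qed

lemma formal_exp_nth_0 [simp]: "formal_exp g $ 0 = 1"
  by (simp add: formal_exp_def pCons_one)

lemma fps_deriv_formal_exp:
  assumes "g $ 0 = 0"
  shows "fps_deriv (formal_exp g) = fps_deriv g * formal_exp g"
proof -
  have "fps_deriv (map_fps (\<lambda>r. [:rat_const r:]) (fps_exp 1))
      = map_fps (\<lambda>r. [:rat_const r:]) (fps_exp 1)"
  proof (rule fps_ext)
    fix n
    have "(of_nat (Suc n) :: rat) * (1 / fact (Suc n)) = 1 / fact n"
      by (simp add: divide_simps del: of_nat_Suc)
    then have "of_nat (Suc n) * [:rat_const (1 / fact (Suc n)):] = [:rat_const (1 / fact n):]"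
      by (simp only: of_nat_mult_conv_smult smult_pCons smult_0_right of_nat_mult_rat_const)
    then show "fps_deriv (map_fps (\<lambda>r. [:rat_const r:]) (fps_exp 1)) $ n
      = map_fps (\<lambda>r. [:rat_const r:]) (fps_exp 1) $ n"
      by (simp del: of_nat_Suc fact_Suc)
  qed
  then show ?thesis
    using assms by (simp add: formal_exp_def fps_compose_deriv mult.commute)
qed

lemma formal_exp_unique:
  assumes "fps_deriv u = fps_deriv g * u" "u $ 0 = 1" "g $ 0 = 0"
  shows "formal_exp g = u"
  by (rule fps_linear_ode_unique[of _ "fps_deriv g"]) (use assms in \<open>auto simp: fps_deriv_formal_exp\<close>)

lemma formal_exp_add:
  assumes "g $ 0 = 0" "h $ 0 = 0"
  shows "formal_exp (g + h) = formal_exp g * formal_exp h"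
  by (rule formal_exp_unique) (use assms in \<open>auto simp: fps_deriv_formal_exp algebra_simps\<close>)

lemma formal_exp_compose:
  assumes "g $ 0 = 0" "h $ 0 = 0"
  shows "formal_exp g oo h = formal_exp (g oo h)"
  using assms by (simp add: formal_exp_def fps_compose_assoc)

lemma formal_ln_nth_0 [simp]: "formal_ln g $ 0 = 0"
  by (simp add: formal_ln_def)

lemma fps_deriv_formal_ln:
  assumes "q $ 0 = 1"
  shows "q * fps_deriv (formal_ln q) = fps_deriv q"
proof -
  let ?l = "map_fps rat_const (fps_ln 1)"
  have "fps_deriv ?l = map_fps rat_const (fps_deriv (fps_ln 1))"
    by (rule fps_ext) (simp add: rat_const_mult rat_const_add)
  also have "\<dots> = Abs_fps (\<lambda>n. rat_const ((-1) ^ n))"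
    by (rule fps_ext) (simp add: fps_ln_deriv fps_inverse_fps_X_plus1)
  finally have l: "fps_deriv ?l = Abs_fps (\<lambda>n. rat_const ((-1) ^ n))" .
  have "(1 + fps_X) * fps_deriv ?l = 1"
  proof (rule fps_ext)
    fix n show "((1 + fps_X) * fps_deriv ?l) $ n = 1 $ n"
      by (cases n) (auto simp: l distrib_right simp flip: rat_const_add)
  qed
  then have "((1 + fps_X) * fps_deriv ?l) oo (q - 1) = 1"
    by simp
  then have "((1 + fps_X) oo (q - 1)) * (fps_deriv ?l oo (q - 1)) = 1"
    using assms by (subst (asm) fps_compose_mult_distrib) auto
  moreover have "(1 + fps_X) oo (q - 1) = q"
    using assms by (simp add: fps_compose_add_distrib)
  ultimately show ?thesis
    using assms by (simp add: formal_ln_def fps_compose_deriv flip: mult.assoc)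
qed

section \<open>The shift of \<open>n\<close> and the diagonal of a bounded series\<close>

definition back_shift :: "nat \<Rightarrow> 'a :: comm_ring_1 poly \<Rightarrow> 'a poly" where
  "back_shift m p = pcompose p [:- of_nat m, 1:]"

lemma back_shift_mult: "back_shift m (p * q) = back_shift m p * back_shift m q"
  by (simp add: back_shift_def pcompose_mult)

lemma back_shift_smult: "back_shift m (smult a p) = smult a (back_shift m p)"
  by (simp add: back_shift_def pcompose_smult)

lemma back_shift_sum: "back_shift m (sum f A) = (\<Sum>i\<in>A. back_shift m (f i))"
  by (simp add: back_shift_def pcompose_sum)

lemma back_shift_const [simp]: "back_shift m [:a:] = [:a:]"
  by (simp add: back_shift_def)

lemma back_shift_0 [simp]: "back_shift m 0 = 0"
  by (simp add: back_shift_def)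

lemma back_shift_1 [simp]: "back_shift m 1 = 1"
  by (simp add: back_shift_def pcompose_1)

lemma back_shift_back_shift: "back_shift m (back_shift l p) = back_shift (l + m) p"
  unfolding back_shift_def pcompose_assoc[symmetric] by (simp add: pcompose_pCons)

lemma poly_back_shift: "poly (back_shift m p) x = poly p (x - of_nat m)"
  by (simp add: back_shift_def poly_pcompose)

lemma back_shift_pCons: "back_shift m (pCons a p) = [:a:] + [:- of_nat m, 1:] * back_shift m p"
  by (simp add: back_shift_def pcompose_pCons)

lemma back_shift_minus_self:
  fixes p :: "'a :: comm_ring_1 poly"
  assumes "degree p \<le> Suc d"
  shows "degree (back_shift m p - p) \<le> d"
    and "coeff (back_shift m p - p) d = - of_nat (m * Suc d) * coeff p (Suc d)"
proof -
  have "degree (back_shift m p - p) \<le> d \<and>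
    coeff (back_shift m p - p) d = - of_nat (m * Suc d) * coeff p (Suc d)"
    using assms
  proof (induction d arbitrary: p)
    case 0
    obtain a r where p: "p = pCons a r" by (cases p)
    with 0 have "degree r = 0" by (auto split: if_splits)
    then obtain b where "r = [:b:]" by (rule degree_eq_zeroE)
    with p show ?case by (simp add: back_shift_pCons)
  next
    case (Suc d)
    obtain a r where p: "p = pCons a r" by (cases p)
    with Suc.prems have r: "degree r \<le> Suc d" by (auto split: if_splits)
    define D where "D = back_shift m r - r"
    have IH: "degree D \<le> d" "coeff D d = - of_nat (m * Suc d) * coeff r (Suc d)"
      using Suc.IH[OF r] by (auto simp: D_def)
    have eq: "back_shift m p - p = pCons 0 D - smult (of_nat m) (D + r)"
      by (simp add: p back_shift_pCons D_def algebra_simps)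
    have "degree (pCons 0 D) \<le> Suc d" "degree (D + r) \<le> Suc d"
      using IH r by (auto intro: degree_add_le)
    then have "degree (back_shift m p - p) \<le> Suc d"
      unfolding eq by (intro degree_diff_le) (auto intro: order.trans[OF degree_smult_le])
    moreover have "coeff D (Suc d) = 0"
      using IH by (intro coeff_eq_0) auto
    ultimately show ?case
      unfolding eq by (simp add: IH(2) p) (simp add: algebra_simps)
  qed
  then show "degree (back_shift m p - p) \<le> d"
    "coeff (back_shift m p - p) d = - of_nat (m * Suc d) * coeff p (Suc d)"
    by auto
qed

lemma coeff_back_shift:
  fixes p :: "'a :: comm_ring_1 poly"
  assumes "degree p \<le> d"
  shows "degree (back_shift m p) \<le> d" "coeff (back_shift m p) d = coeff p d"
proof -
  have *: "back_shift m p = (back_shift m p - p) + p" by simp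
  have d: "degree (back_shift m p - p) \<le> d" using back_shift_minus_self[of p d] assms by auto
  show "degree (back_shift m p) \<le> d"
    using degree_add_le[OF d assms] by simp
  have "coeff (back_shift m p - p) d = 0"
    using back_shift_minus_self(2)[of p d m] assms by (simp add: coeff_eq_0)
  then show "coeff (back_shift m p) d = coeff p d" by simp
qed

lemma degree_le_if_back_shift_diff:
  fixes p :: "'a :: {idom, ring_char_0} poly"
  assumes "degree (p - back_shift 1 p) \<le> k" and "coeff (p - back_shift 1 p) k = 0"
  shows "degree p \<le> k"
proof (rule ccontr)
  assume *: "\<not> degree p \<le> k"
  define d where "d = degree p - 1"
  have d: "degree p = Suc d" "d \<ge> k" using * by (auto simp: d_def)
  have "coeff (p - back_shift 1 p) d = 0"
    using assms d by (cases "d = k") (simp_all only: coeff_eq_0[of _ d])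
  then have "of_nat (Suc d) * coeff p (Suc d) = 0"
    using back_shift_minus_self(2)[of p d 1] d by (simp add: algebra_simps)
  then show False
    using d leading_coeff_0_iff[of p] by (auto simp del: of_nat_Suc)
qed

definition diag_bounded :: "'a :: comm_ring_1 poly fps \<Rightarrow> bool" where
  "diag_bounded g \<longleftrightarrow> (\<forall>j. degree (g $ j) \<le> j)"

definition diag :: "'a :: comm_ring_1 poly fps \<Rightarrow> 'a fps" where
  "diag g = Abs_fps (\<lambda>j. coeff (g $ j) j)"

lemma diag_nth [simp]: "diag g $ j = coeff (g $ j) j"
  by (simp add: diag_def)

lemma coeff_mult_add_degree_le:
  assumes "degree p \<le> a" "degree q \<le> b"
  shows "coeff (p * q) (a + b) = coeff p a * coeff q b"
proof -
  have "coeff (p * q) (a + b) = (\<Sum>i\<le>a + b. if i = a then coeff p a * coeff q b else 0)"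
    unfolding coeff_mult
  proof (rule sum.cong[OF refl])
    fix i assume "i \<in> {..a + b}"
    then consider "i < a" "b < a + b - i" | "i = a" | "i > a" by force
    then show "coeff p i * coeff q (a + b - i) = (if i = a then coeff p a * coeff q b else 0)"
      using assms by cases (auto simp: coeff_eq_0)
  qed
  then show ?thesis by simp
qed

lemma diag_bounded_mult:
  assumes "diag_bounded g" "diag_bounded h"
  shows "diag_bounded (g * h)"
  unfolding diag_bounded_def fps_mult_nth
proof (intro allI degree_sum_le)
  fix j i :: nat assume "i \<in> {0..j}"
  then show "degree (g $ i * h $ (j - i)) \<le> j"
    using assms order.trans[OF degree_mult_le[of "g $ i" "h $ (j - i)"] add_mono[of _ i _ "j - i"]]
    by (simp add: diag_bounded_def)
qed auto

lemma diag_mult: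
  assumes "diag_bounded g" "diag_bounded h"
  shows "diag (g * h) = diag g * diag h"
proof (rule fps_ext)
  fix j
  show "diag (g * h) $ j = (diag g * diag h) $ j"
    unfolding diag_nth fps_mult_nth coeff_sum
  proof (rule sum.cong[OF refl])
    fix i assume "i \<in> {0..j}"
    then show "coeff (g $ i * h $ (j - i)) j = coeff (g $ i) i * coeff (h $ (j - i)) (j - i)"
      using coeff_mult_add_degree_le[of "g $ i" i "h $ (j - i)" "j - i"] assms
      by (simp add: diag_bounded_def)
  qed
qed

lemma degree_of_nat_mult:
  "degree (of_nat (Suc n) * p) = degree (p :: 'a :: {idom, ring_char_0} poly)"
  by (simp add: of_nat_mult_conv_smult del: of_nat_Suc)

lemma formal_exp_nth_Suc:
  assumes "g $ 0 = 0"
  shows "of_nat (Suc j) * formal_exp g $ Suc j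
    = (\<Sum>i=0..j. of_nat (Suc i) * g $ Suc i * formal_exp g $ (j - i))"
  using arg_cong[OF fps_deriv_formal_exp[OF assms], of "\<lambda>h. h $ j"]
  by (simp add: fps_mult_nth del: of_nat_Suc)

lemma diag_bounded_formal_exp:
  assumes "diag_bounded g" "g $ 0 = 0"
  shows "diag_bounded (formal_exp g)"
  unfolding diag_bounded_def
proof
  fix j show "degree (formal_exp g $ j) \<le> j"
  proof (induction j rule: less_induct)
    case (less j)
    show ?case
    proof (cases j)
      case (Suc k)
      have "degree (of_nat (Suc k) * formal_exp g $ Suc k) \<le> Suc k"
        unfolding formal_exp_nth_Suc[OF assms(2)]
      proof (rule degree_sum_le)
        fix i assume i: "i \<in> {0..k}"
        have "degree (of_nat (Suc i) * g $ Suc i * formal_exp g $ (k - i)) \<le> Suc i + (k - i)"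
          using assms(1) less[of "k - i"] Suc i
          by (intro order.trans[OF degree_mult_le] add_mono)
            (auto simp: degree_of_nat_mult diag_bounded_def simp del: of_nat_Suc)
        with i show "degree (of_nat (Suc i) * g $ Suc i * formal_exp g $ (k - i)) \<le> Suc k"
          by simp
      qed simp
      then show ?thesis unfolding degree_of_nat_mult Suc .
    qed simp
  qed
qed

lemma coeff_of_nat_mult: "coeff (of_nat n * p) j = of_nat n * coeff p j"
  by (simp add: of_nat_mult_conv_smult)

lemma fps_deriv_diag_formal_exp:
  assumes "diag_bounded g" "g $ 0 = 0"
  shows "fps_deriv (diag (formal_exp g)) = fps_deriv (diag g) * diag (formal_exp g)"
proof (rule fps_ext)
  fix j
  have "fps_deriv (diag (formal_exp g)) $ j = coeff (of_nat (Suc j) * formal_exp g $ Suc j) (Suc j)"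
    by (simp add: coeff_of_nat_mult del: of_nat_Suc)
  also have "\<dots> = (\<Sum>i=0..j. of_nat (Suc i) * coeff (g $ Suc i) (Suc i)
      * coeff (formal_exp g $ (j - i)) (j - i))"
    unfolding formal_exp_nth_Suc[OF assms(2)] coeff_sum
  proof (rule sum.cong[OF refl])
    fix i assume i: "i \<in> {0..j}"
    have "coeff (of_nat (Suc i) * g $ Suc i * formal_exp g $ (j - i)) (Suc i + (j - i))
      = coeff (of_nat (Suc i) * g $ Suc i) (Suc i) * coeff (formal_exp g $ (j - i)) (j - i)"
      using assms(1) diag_bounded_formal_exp[OF assms]
      by (intro coeff_mult_add_degree_le)
        (auto simp: degree_of_nat_mult diag_bounded_def simp del: of_nat_Suc)
    with i show "coeff (of_nat (Suc i) * g $ Suc i * formal_exp g $ (j - i)) (Suc j)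
      = of_nat (Suc i) * coeff (g $ Suc i) (Suc i) * coeff (formal_exp g $ (j - i)) (j - i)"
      by (simp add: coeff_of_nat_mult del: of_nat_Suc)
  qed
  also have "\<dots> = (fps_deriv (diag g) * diag (formal_exp g)) $ j"
    by (simp add: fps_mult_nth del: of_nat_Suc)
  finally show "fps_deriv (diag (formal_exp g)) $ j
    = (fps_deriv (diag g) * diag (formal_exp g)) $ j" .
qed

section \<open>The series \<open>s\<close> and the shifted approximation\<close>

lemma fps_power_nth_cong:
  assumes "\<And>i. i \<le> n \<Longrightarrow> p $ i = q $ i"
  shows "(p ^ k) $ n = (q ^ k) $ n"
  using assms
proof (induction k arbitrary: n)
  case (Suc k)
  then show ?case by (auto simp: fps_mult_nth intro!: sum.cong)
qed simp

lemma fps_contraction_has_unique_fixpoint: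
  fixes \<Psi> :: "'a :: zero fps \<Rightarrow> 'a fps"
  assumes contr: "\<And>p q n. (\<And>i. i < n \<Longrightarrow> p $ i = q $ i) \<Longrightarrow> \<Psi> p $ n = \<Psi> q $ n"
  shows "\<exists>!q. \<Psi> q = q"
proof (rule ex_ex1I)
  define Q where "Q N = (\<Psi> ^^ N) 0" for N
  have step: "Q N $ i = Q (Suc N) $ i" if "i < N" for N i
    using that
  proof (induction N arbitrary: i)
    case (Suc N)
    then show ?case by (auto simp: Q_def intro!: contr)
  qed simp
  have stable: "Q N $ i = Q (Suc i) $ i" if "i < N" for N i
    using Suc_leI[OF that]
  proof (induction N rule: dec_induct)
    case (step n)
    then show ?case using \<open>\<And>N i. i < N \<Longrightarrow> Q N $ i = Q (Suc N) $ i\<close>[of i n] by simp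
  qed simp
  define q where "q = Abs_fps (\<lambda>i. Q (Suc i) $ i)"
  have "\<Psi> q $ i = q $ i" for i
  proof -
    have "\<Psi> q $ i = \<Psi> (Q (Suc i)) $ i"
      using stable[of _ "Suc i"] by (intro contr) (simp add: q_def)
    also have "\<dots> = Q (Suc (Suc i)) $ i" by (simp add: Q_def)
    finally show ?thesis using stable[of i "Suc (Suc i)"] by (simp add: q_def)
  qed
  then show "\<exists>q. \<Psi> q = q" by (blast intro: fps_ext)
next
  fix p q assume *: "\<Psi> p = p" "\<Psi> q = q"
  have "p $ n = q $ n" for n
    using contr[of _ p q] by (induction n rule: less_induct) (simp add: *)
  then show "p = q" by (rule fps_ext)
qed

lemma fps_mult_compose_X_mult_nth:
  fixes q :: "'a :: idom fps"
  shows "(q * (g oo (fps_X * q))) $ n = (\<Sum>i\<le>n. g $ i * (q ^ Suc i) $ (n - i))"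
proof -
  have "(g oo (fps_X * q)) $ m = (\<Sum>i\<le>n. fps_const (g $ i) * (fps_X * q) ^ i) $ m" if "m \<le> n" for m
  proof -
    have "(g oo (fps_X * q)) $ m = (\<Sum>i\<le>m. g $ i * ((fps_X * q) ^ i) $ m)"
      by (simp add: fps_compose_nth atMost_atLeast0)
    also have "\<dots> = (\<Sum>i\<le>n. g $ i * ((fps_X * q) ^ i) $ m)"
      using that by (intro sum.mono_neutral_left) (auto simp: power_mult_distrib fps_X_power_mult_nth)
    finally show ?thesis by (simp add: fps_sum_nth)
  qed
  then have "(q * (g oo (fps_X * q))) $ n = (q * (\<Sum>i\<le>n. fps_const (g $ i) * (fps_X * q) ^ i)) $ n"
    by (simp add: fps_mult_nth)
  also have "q * (\<Sum>i\<le>n. fps_const (g $ i) * (fps_X * q) ^ i)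
    = (\<Sum>i\<le>n. fps_const (g $ i) * (fps_X ^ i * q ^ Suc i))"
    by (simp add: sum_distrib_left power_mult_distrib mult_ac)
  also have "\<dots> $ n = (\<Sum>i\<le>n. g $ i * (q ^ Suc i) $ (n - i))"
    unfolding fps_sum_nth fps_mult_left_const_nth
    by (intro sum.cong) (auto simp: fps_X_power_mult_nth simp del: power_Suc)
  finally show ?thesis .
qed

lemma ex1_mult_compose_eq_X:
  fixes g :: "'a :: idom fps"
  assumes "g $ 0 = 1"
  shows "\<exists>!s. s $ 0 = 0 \<and> s * (g oo s) = fps_X"
proof -
  define \<Psi> where "\<Psi> q = Abs_fps (\<lambda>n. 1 $ n - (\<Sum>i\<in>{1..n}. g $ i * (q ^ Suc i) $ (n - i)))"
    for q :: "'a fps"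
  have "\<exists>!q. \<Psi> q = q"
    unfolding \<Psi>_def
    by (rule fps_contraction_has_unique_fixpoint)
      (auto intro!: sum.cong arg_cong[of _ _ "\<lambda>x. _ * x"] fps_power_nth_cong simp del: power_Suc)
  moreover have fix_iff: "\<Psi> q = q \<longleftrightarrow> q * (g oo (fps_X * q)) = 1" for q
  proof -
    have "(q * (g oo (fps_X * q))) $ n = q $ n + (\<Sum>i\<in>{1..n}. g $ i * (q ^ Suc i) $ (n - i))" for n
      unfolding fps_mult_compose_X_mult_nth atMost_atLeast0
      by (subst sum.atLeast_Suc_atMost) (auto simp: assms)
    then show ?thesis
      by (auto simp: fps_eq_iff \<Psi>_def algebra_simps)
  qed
  ultimately obtain q where q: "q * (g oo (fps_X * q)) = 1"
    and q_unique: "\<And>p. p * (g oo (fps_X * p)) = 1 \<Longrightarrow> p = q" by metis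
  show ?thesis
  proof (rule ex1I[of _ "fps_X * q"])
    show "(fps_X * q) $ 0 = 0 \<and> fps_X * q * (g oo (fps_X * q)) = fps_X"
      using q by (simp add: mult.assoc)
  next
    fix s assume s: "s $ 0 = 0 \<and> s * (g oo s) = fps_X"
    define p where "p = fps_shift 1 s"
    have s_eq: "s = fps_X * p"
      using s by (simp add: p_def fps_eq_iff)
    then have "fps_X * (p * (g oo (fps_X * p))) = fps_X * 1"
      using s by (simp add: mult.assoc)
    then show "s = fps_X * q"
      using q_unique[of p] s_eq by simp
  qed
qed

lemma fps_deriv_f_series_nth:
  "fps_deriv f_series $ j = (if j = 0 then 1 else rat_const (1 / fact j) * indet (Suc j))"
proof (cases j)
  case (Suc i)
  have "of_nat (Suc j) * rat_const (1 / fact (Suc j)) = rat_const (1 / fact j)"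
    unfolding of_nat_mult_rat_const
    by (intro arg_cong[of _ _ rat_const]) (simp add: divide_simps del: of_nat_Suc)
  with Suc show ?thesis
    by (simp add: f_series_def flip: mult.assoc del: of_nat_Suc fact_Suc)
qed (simp add: f_series_def)

lemma s_series_nth_0: "s_series $ 0 = 0"
  and s_series_eq: "s_series * (fps_deriv f_series oo s_series) = fps_X"
proof -
  have "\<exists>!s. s $ 0 = 0 \<and> s * (fps_deriv f_series oo s) = fps_X"
    by (rule ex1_mult_compose_eq_X) (simp add: fps_deriv_f_series_nth del: fps_deriv_nth)
  from theI'[OF this] show "s_series $ 0 = 0" "s_series * (fps_deriv f_series oo s_series) = fps_X"
    by (auto simp: s_series_def)
qed

lemma s_series_eq_X_mult: "s_series = fps_X * s_over_y"
  using s_series_nth_0 by (simp add: s_over_y_def fps_eq_iff)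

lemma s_over_y_eq: "s_over_y * (fps_deriv f_series oo s_series) = 1"
proof -
  have "fps_X * (s_over_y * (fps_deriv f_series oo s_series)) = fps_X * 1"
    using s_series_eq unfolding s_series_eq_X_mult by (simp add: mult.assoc)
  then show ?thesis by simp
qed

lemma s_over_y_nth_0 [simp]: "s_over_y $ 0 = 1"
  using arg_cong[OF s_over_y_eq, of "\<lambda>h. h $ 0"]
  by (simp add: fps_deriv_f_series_nth del: fps_deriv_nth)

definition log_factor :: "coeff_ring fps" where
  "log_factor = s_over_y * (fps_shift 1 f_series oo s_series) - 1 - formal_ln s_over_y"

lemma log_factor_nth_0 [simp]: "log_factor $ 0 = 0"
  by (simp add: log_factor_def f_series_def)

lemma fps_deriv_X_mult_log_factor: "fps_deriv (fps_X * log_factor) = - formal_ln s_over_y"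
proof -
  let ?q = s_over_y and ?l = "formal_ln s_over_y"
  have "f_series = fps_X * fps_shift 1 f_series"
    by (simp add: fps_eq_iff f_series_def)
  then have "f_series oo s_series = (fps_X * fps_shift 1 f_series) oo s_series"
    by simp
  also have "\<dots> = s_series * (fps_shift 1 f_series oo s_series)"
    by (simp add: s_series_nth_0 fps_compose_mult_distrib)
  finally have "fps_X * log_factor = (f_series oo s_series) - fps_X - fps_X * ?l"
    by (simp add: log_factor_def s_series_eq_X_mult algebra_simps)
  then have eq: "fps_deriv (fps_X * log_factor) + ?l
    = (fps_deriv f_series oo s_series) * fps_deriv s_series - 1 - fps_X * fps_deriv ?l"
    by (simp add: fps_compose_deriv s_series_nth_0)
  have "?q * (fps_deriv (fps_X * log_factor) + ?l)
    = ?q * (fps_deriv f_series oo s_series) * fps_deriv s_series - ?q - fps_X * (?q * fps_deriv ?l)"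
    unfolding eq by (simp add: algebra_simps)
  also have "\<dots> = 0"
    unfolding s_over_y_eq fps_deriv_formal_ln[OF s_over_y_nth_0]
    by (simp add: s_series_eq_X_mult)
  finally have "fps_deriv (fps_X * log_factor) + ?l = 0"
    using s_over_y_nth_0 unfolding mult_eq_0_iff by (metis fps_zero_nth zero_neq_one)
  then show ?thesis by (simp add: eq_neg_iff_add_eq_0)
qed

definition log_tilde :: "coeff_ring poly fps" where
  "log_tilde = Abs_fps (\<lambda>j. monom (log_factor $ j) (Suc j))"

lemma log_tilde_nth [simp]: "log_tilde $ j = monom (log_factor $ j) (Suc j)"
  by (simp add: log_tilde_def)

lemma F_tilde_factor_eq_formal_exp: "F_tilde_factor = formal_exp log_tilde"
proof -
  let ?a = "poly_var * lift_const (s_over_y * (fps_shift 1 f_series oo s_series)) - poly_var"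
  let ?b = "- (poly_var * lift_const (formal_ln s_over_y))"
  have sum0: "?a + ?b = poly_var * lift_const log_factor"
  proof (rule fps_ext)
    fix j show "(?a + ?b) $ j = (poly_var * lift_const log_factor) $ j"
      by (cases j) (simp_all add: poly_var_def log_factor_def)
  qed
  have "F_tilde_factor_y = formal_exp ?a * formal_exp ?b"
    by (simp add: F_tilde_factor_y_def)
  also have "\<dots> = formal_exp (?a + ?b)"
    by (rule formal_exp_add[symmetric]) (simp_all add: poly_var_def f_series_def)
  also have "\<dots> = formal_exp (poly_var * lift_const log_factor)"
    by (simp only: sum0)
  finally have "F_tilde_factor = formal_exp (poly_var * lift_const log_factor oo y_series)"
    unfolding F_tilde_factor_def
    by (subst formal_exp_compose[symmetric]) (simp_all add: poly_var_def y_series_def)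
  also have "poly_var * lift_const log_factor oo y_series = log_tilde"
  proof (rule fps_ext)
    fix j
    have "[:0, 1:] ^ j * ([:0, 1:] * [:a:]) = monom a (Suc j)" for a :: coeff_ring
      by (simp add: monom_altdef mult_ac)
    then show "(poly_var * lift_const log_factor oo y_series) $ j = log_tilde $ j"
      by (simp add: poly_var_def y_series_def)
  qed
  finally show ?thesis .
qed

lemma fps_back_shift_mult:
  "map_fps (back_shift m) (g * h) = map_fps (back_shift m) g * map_fps (back_shift m) h"
  by (rule fps_ext) (simp add: fps_mult_nth back_shift_sum back_shift_mult)

lemma fps_back_shift_deriv:
  "map_fps (back_shift m) (fps_deriv g) = fps_deriv (map_fps (back_shift m) g)"
  by (rule fps_ext) (simp add: of_nat_mult_conv_smult back_shift_smult del: of_nat_Suc)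

lemma fps_back_shift_formal_exp:
  assumes "g $ 0 = 0"
  shows "map_fps (back_shift m) (formal_exp g) = formal_exp (map_fps (back_shift m) g)"
  by (rule formal_exp_unique[symmetric])
    (use assms in \<open>simp_all add: fps_deriv_formal_exp fps_back_shift_mult flip: fps_back_shift_deriv\<close>)

definition shift_quotient :: "nat \<Rightarrow> coeff_ring poly fps" where
  "shift_quotient m = formal_exp (map_fps (back_shift m) log_tilde - log_tilde)"

lemma fps_back_shift_F_tilde_factor:
  "map_fps (back_shift m) F_tilde_factor = F_tilde_factor * shift_quotient m"
  unfolding shift_quotient_def F_tilde_factor_eq_formal_exp
  by (simp add: fps_back_shift_formal_exp flip: formal_exp_add)

lemma diag_bounded_shift_log:
  "diag_bounded (map_fps (back_shift m) log_tilde - log_tilde)"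
  using back_shift_minus_self(1)[of "log_tilde $ j" j m for j]
  by (simp add: diag_bounded_def degree_monom_le)

lemma diag_shift_log:
  "diag (map_fps (back_shift m) log_tilde - log_tilde) = of_nat m * formal_ln s_over_y"
proof (rule fps_ext)
  fix j
  have "diag (map_fps (back_shift m) log_tilde - log_tilde) $ j
    = of_nat m * - (fps_deriv (fps_X * log_factor) $ j)"
    using back_shift_minus_self(2)[of "log_tilde $ j" j m]
    by (simp add: degree_monom_le algebra_simps)
  then show "diag (map_fps (back_shift m) log_tilde - log_tilde) $ j
    = (of_nat m * formal_ln s_over_y) $ j"
    unfolding fps_deriv_X_mult_log_factor by simp
qed

lemma diag_bounded_shift_quotient: "diag_bounded (shift_quotient m)"
  unfolding shift_quotient_def
  by (rule diag_bounded_formal_exp[OF diag_bounded_shift_log]) simp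

lemma diag_shift_quotient: "diag (shift_quotient m) = s_over_y ^ m"
proof (rule fps_linear_ode_unique)
  show "fps_deriv (diag (shift_quotient m))
    = fps_deriv (of_nat m * formal_ln s_over_y) * diag (shift_quotient m)"
    unfolding shift_quotient_def
    by (subst fps_deriv_diag_formal_exp[OF diag_bounded_shift_log]) (simp_all add: diag_shift_log)
  show "fps_deriv (s_over_y ^ m) = fps_deriv (of_nat m * formal_ln s_over_y) * s_over_y ^ m"
  proof (cases m)
    case (Suc k)
    have "fps_deriv (s_over_y ^ m) = of_nat m * (s_over_y * fps_deriv (formal_ln s_over_y)) * s_over_y ^ k"
      unfolding fps_deriv_formal_ln[OF s_over_y_nth_0]
      unfolding Suc fps_deriv_power' by (simp add: mult_ac del: of_nat_Suc power_Suc)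
    then show ?thesis by (simp add: Suc mult_ac)
  qed simp
qed (simp add: shift_quotient_def fps_power_zeroth)

section \<open>The polynomials \<open>\<phi>\<^sub>k\<close>\<close>

lemma degree_falling_poly: "degree (falling_poly m) \<le> m"
proof (induction m)
  case (Suc m)
  have "falling_poly (Suc m) = falling_poly m * [:- of_nat m, 1:]"
    by (simp add: falling_poly_def)
  then show ?case
    using Suc degree_mult_le[of "falling_poly m" "[:- of_nat m, 1:]"] by simp
qed (simp add: falling_poly_def)

lemma falling_poly_0 [simp]: "falling_poly 0 = 1"
  by (simp add: falling_poly_def)

lemma falling_poly_Suc: "falling_poly (Suc m) = falling_poly m * [:- of_nat m, 1:]"
  by (simp add: falling_poly_def)

lemma lead_coeff_falling_poly: "coeff (falling_poly m) m = 1"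
proof (induction m)
  case (Suc m)
  then show ?case
    using coeff_mult_add_degree_le[OF degree_falling_poly, of "[:- of_nat m, 1:]" 1 m]
    by (simp add: falling_poly_Suc)
qed simp

lemma falling_poly_add:
  "falling_poly (m + l) = falling_poly m * back_shift m (falling_poly l)"
proof (induction l)
  case (Suc l)
  have "back_shift m [:- of_nat l, 1:] = [:- of_nat (m + l), 1 :: coeff_ring:]"
    by (simp add: back_shift_pCons)
  then show ?case
    unfolding add_Suc_right falling_poly_Suc back_shift_mult Suc by (simp only: mult.assoc)
qed simp

lemma falling_poly_minus_back_shift:
  "falling_poly m - back_shift 1 (falling_poly m) = of_nat m * back_shift 1 (falling_poly (m - 1))"
proof (cases m)
  case (Suc l)
  have "falling_poly m = [:0, 1:] * back_shift 1 (falling_poly l)"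
    using falling_poly_add[of 1 l] by (simp add: Suc falling_poly_Suc[of 0])
  moreover have "back_shift 1 (falling_poly m) = [:- of_nat (Suc l), 1:] * back_shift 1 (falling_poly l)"
  proof -
    have "back_shift 1 [:- of_nat l, 1:] = [:- of_nat (Suc l), 1 :: coeff_ring:]"
      by (simp add: back_shift_pCons)
    then show ?thesis
      unfolding Suc falling_poly_Suc back_shift_mult by (simp only: mult.commute)
  qed
  moreover have "[:0, 1:] - [:- of_nat (Suc l), 1:] = (of_nat m :: coeff_ring poly)"
    by (simp add: Suc of_nat_poly)
  ultimately show ?thesis
    by (simp only: flip: left_diff_distrib) (simp add: Suc)
qed simp

lemma poly_falling_poly_eq_0: "n < m \<Longrightarrow> poly (falling_poly m) (of_nat n) = 0"
  by (auto simp: falling_poly_def poly_prod)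

lemma poly_falling_poly:
  "m \<le> n \<Longrightarrow> rat_const (1 / fact n) * poly (falling_poly m) (of_nat n) = rat_const (1 / fact (n - m))"
proof (induction m)
  case (Suc m)
  have "poly (falling_poly (Suc m)) (of_nat n) = poly (falling_poly m) (of_nat n) * of_nat (n - m)"
    using Suc.prems by (simp add: falling_poly_Suc of_nat_diff algebra_simps)
  then have "rat_const (1 / fact n) * poly (falling_poly (Suc m)) (of_nat n)
    = rat_const (1 / fact (n - m)) * of_nat (n - m)"
    using Suc by (simp flip: mult.assoc)
  also have "\<dots> = rat_const (1 / fact (n - m) * of_nat (n - m))"
    by (simp only: rat_const_mult rat_const_of_nat)
  also have "(1 :: rat) / fact (n - m) * of_nat (n - m) = 1 / fact (n - Suc m)"
    using Suc.prems by (simp add: fact_reduce[of "n - m"] divide_simps)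
  finally show ?case .
qed simp

definition weight :: "(nat \<Rightarrow>\<^sub>0 nat) \<Rightarrow> coeff_ring" where
  "weight \<kappa> = (\<Prod>i\<in>Poly_Mapping.keys \<kappa>.
     rat_const (1 / (fact i ^ Poly_Mapping.lookup \<kappa> i * fact (Poly_Mapping.lookup \<kappa> i)))
     * indet i ^ Poly_Mapping.lookup \<kappa> i)"

definition moment :: "(nat \<Rightarrow> nat) \<Rightarrow> (nat \<Rightarrow>\<^sub>0 nat) \<Rightarrow> nat" where
  "moment c \<kappa> = (\<Sum>i\<in>Poly_Mapping.keys \<kappa>. c i * Poly_Mapping.lookup \<kappa> i)"

lemma moment_superset:
  assumes "finite S" "Poly_Mapping.keys \<kappa> \<subseteq> S"
  shows "moment c \<kappa> = (\<Sum>i\<in>S. c i * Poly_Mapping.lookup \<kappa> i)"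
  unfolding moment_def using assms by (intro sum.mono_neutral_left) (auto simp: in_keys_iff)

lemma moment_add_single: "moment c (\<kappa> + Poly_Mapping.single m 1) = moment c \<kappa> + c m"
proof -
  let ?S = "insert m (Poly_Mapping.keys \<kappa>)"
  have "moment c (\<kappa> + Poly_Mapping.single m 1)
    = (\<Sum>i\<in>?S. c i * Poly_Mapping.lookup (\<kappa> + Poly_Mapping.single m 1) i)"
    using keys_add[of \<kappa> "Poly_Mapping.single m 1"] by (intro moment_superset) auto
  also have "\<dots> = (\<Sum>i\<in>?S. c i * Poly_Mapping.lookup \<kappa> i) + (\<Sum>i\<in>?S. if i = m then c m else 0)"
    unfolding sum.distrib[symmetric]
    by (intro sum.cong) (auto simp: lookup_add lookup_single when_def algebra_simps)
  also have "(\<Sum>i\<in>?S. c i * Poly_Mapping.lookup \<kappa> i) = moment c \<kappa>"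
    by (rule moment_superset[symmetric]) auto
  finally show ?thesis by simp
qed

lemma weight_superset:
  assumes "finite S" "Poly_Mapping.keys \<kappa> \<subseteq> S"
  shows "weight \<kappa> = (\<Prod>i\<in>S.
     rat_const (1 / (fact i ^ Poly_Mapping.lookup \<kappa> i * fact (Poly_Mapping.lookup \<kappa> i)))
     * indet i ^ Poly_Mapping.lookup \<kappa> i)"
  unfolding weight_def using assms by (intro prod.mono_neutral_left) (auto simp: in_keys_iff)

lemma weight_add_single:
  assumes "m \<ge> 1"
  shows "of_nat (m * Suc (Poly_Mapping.lookup \<kappa> m)) * weight (\<kappa> + Poly_Mapping.single m 1)
    = rat_const (1 / fact (m - 1)) * indet m * weight \<kappa>"
proof -
  let ?\<mu> = "\<kappa> + Poly_Mapping.single m 1"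
  let ?S = "insert m (Poly_Mapping.keys \<kappa>)"
  let ?g = "\<lambda>\<kappa> i. rat_const (1 / (fact i ^ Poly_Mapping.lookup \<kappa> i * fact (Poly_Mapping.lookup \<kappa> i)))
     * indet i ^ Poly_Mapping.lookup \<kappa> i"
  define l where "l = Poly_Mapping.lookup \<kappa> m"
  have "weight ?\<mu> = prod (?g ?\<mu>) ?S"
    using keys_add[of \<kappa> "Poly_Mapping.single m 1"] by (intro weight_superset) auto
  also have "\<dots> = ?g ?\<mu> m * prod (?g ?\<mu>) (?S - {m})"
    by (rule prod.remove) auto
  also have "prod (?g ?\<mu>) (?S - {m}) = prod (?g \<kappa>) (?S - {m})"
    by (intro prod.cong) (auto simp: lookup_add lookup_single)
  finally have \<mu>: "weight ?\<mu> = ?g ?\<mu> m * prod (?g \<kappa>) (?S - {m})" .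
  have "weight \<kappa> = prod (?g \<kappa>) ?S"
    by (intro weight_superset) auto
  also have "\<dots> = ?g \<kappa> m * prod (?g \<kappa>) (?S - {m})"
    by (rule prod.remove) auto
  finally have \<kappa>: "weight \<kappa> = ?g \<kappa> m * prod (?g \<kappa>) (?S - {m})" .
  have "(of_nat (m * Suc l) :: rat) * (1 / (fact m ^ Suc l * fact (Suc l)))
    = 1 / fact (m - 1) * (1 / (fact m ^ l * fact l))"
  proof -
    define a :: rat where "a = fact m ^ l"
    have "(fact m ^ Suc l * fact (Suc l) :: rat) = fact m * (a * (of_nat (Suc l) * fact l))"
      by (simp add: a_def)
    also have "\<dots> = (of_nat m * fact (m - 1)) * (a * (of_nat (Suc l) * fact l))"
      using assms by (subst fact_reduce) simp_all
    finally have eq: "(fact m ^ Suc l * fact (Suc l) :: rat)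
      = of_nat (m * Suc l) * (fact (m - 1) * (a * fact l))"
      by (simp only: of_nat_mult mult_ac)
    have "of_nat (m * Suc l) \<noteq> (0 :: rat)"
      using assms by (simp del: mult_Suc_right)
    then show ?thesis
      unfolding eq by (simp add: a_def del: of_nat_mult of_nat_Suc mult_Suc_right)
  qed
  then have "rat_const (of_nat (m * Suc l)) * rat_const (1 / (fact m ^ Suc l * fact (Suc l)))
    = rat_const (1 / fact (m - 1)) * rat_const (1 / (fact m ^ l * fact l))"
    by (simp only: flip: rat_const_mult)
  then have "of_nat (m * Suc l) * ?g ?\<mu> m = rat_const (1 / fact (m - 1)) * indet m * ?g \<kappa> m"
    by (simp only: rat_const_of_nat lookup_add lookup_single_eq add_Suc_right add_0_right
        One_nat_def power_Suc mult.assoc[symmetric] l_def) (simp only: mult_ac)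
  then show ?thesis
    unfolding \<mu> \<kappa> l_def by (simp only: flip: mult.assoc)
qed

lemma index_families_iff:
  "\<kappa> \<in> index_families k \<longleftrightarrow> Poly_Mapping.keys \<kappa> \<subseteq> {2..} \<and> moment (\<lambda>i. i - 1) \<kappa> = k"
  by (simp add: index_families_def moment_def)

lemma phi_eq: "phi k = (\<Sum>\<kappa>\<in>index_families k. smult (weight \<kappa>) (falling_poly (moment id \<kappa>)))"
  unfolding phi_def
proof (rule sum.cong[OF refl])
  fix \<kappa> assume \<kappa>: "\<kappa> \<in> index_families k"
  have "(i - 1) * l + l = i * l" if "i \<in> Poly_Mapping.keys \<kappa>" for i l
    using that \<kappa> by (cases i) (auto simp: index_families_def)
  then have "moment id \<kappa> = (\<Sum>i\<in>Poly_Mapping.keys \<kappa>.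
      (i - 1) * Poly_Mapping.lookup \<kappa> i + Poly_Mapping.lookup \<kappa> i)"
    by (simp add: moment_def)
  also have "\<dots> = k + (\<Sum>i\<in>Poly_Mapping.keys \<kappa>. Poly_Mapping.lookup \<kappa> i)"
    using \<kappa> by (simp only: index_families_def mem_Collect_eq sum.distrib)
  finally show "smult (\<Prod>i\<in>Poly_Mapping.keys \<kappa>.
        rat_const (1 / (fact i ^ Poly_Mapping.lookup \<kappa> i * fact (Poly_Mapping.lookup \<kappa> i)))
        * indet i ^ Poly_Mapping.lookup \<kappa> i)
      (falling_poly (k + (\<Sum>i\<in>Poly_Mapping.keys \<kappa>. Poly_Mapping.lookup \<kappa> i)))
    = smult (weight \<kappa>) (falling_poly (moment id \<kappa>))"
    by (simp add: weight_def)
qed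

lemma phi_minus_back_shift:
  "phi k - back_shift 1 (phi k) = (\<Sum>m\<in>{2..Suc k}.
     smult (rat_const (1 / fact (m - 1)) * indet m)
       (back_shift 1 (falling_poly (m - 1)) * back_shift m (phi (k - (m - 1)))))"
proof -
  let ?add = "\<lambda>\<kappa> m. \<kappa> + Poly_Mapping.single m 1 :: nat \<Rightarrow>\<^sub>0 nat"
  let ?t = "\<lambda>\<kappa> i. smult (of_nat (i * Poly_Mapping.lookup \<kappa> i) * weight \<kappa>)
      (back_shift 1 (falling_poly (moment id \<kappa> - 1)))"
  have remove_add: "?add (\<kappa> - Poly_Mapping.single i 1) i = \<kappa>" if "i \<in> Poly_Mapping.keys \<kappa>" for \<kappa> i
    using that by (intro poly_mapping_eqI) (auto simp: in_keys_iff lookup_add lookup_minus lookup_single when_def)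
  have "phi k - back_shift 1 (phi k) = (\<Sum>\<kappa>\<in>index_families k.
      smult (weight \<kappa>) (falling_poly (moment id \<kappa>) - back_shift 1 (falling_poly (moment id \<kappa>))))"
    by (simp add: phi_eq back_shift_sum back_shift_smult sum_subtractf smult_diff_right)
  also have "\<dots> = (\<Sum>\<kappa>\<in>index_families k. \<Sum>i\<in>Poly_Mapping.keys \<kappa>. ?t \<kappa> i)"
    unfolding falling_poly_minus_back_shift
  proof (rule sum.cong[OF refl])
    fix \<kappa>
    have "weight \<kappa> * of_nat (moment id \<kappa>)
      = (\<Sum>i\<in>Poly_Mapping.keys \<kappa>. of_nat (i * Poly_Mapping.lookup \<kappa> i) * weight \<kappa>)"
      by (simp add: moment_def sum_distrib_left mult_ac)
    then show "smult (weight \<kappa>) (of_nat (moment id \<kappa>) * back_shift 1 (falling_poly (moment id \<kappa> - 1)))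
      = (\<Sum>i\<in>Poly_Mapping.keys \<kappa>. ?t \<kappa> i)"
      by (simp only: of_nat_mult_conv_smult smult_smult smult_sum)
  qed
  also have "\<dots> = (\<Sum>(\<kappa>, i)\<in>Sigma (index_families k) Poly_Mapping.keys. ?t \<kappa> i)"
    by (rule sum.Sigma) (auto simp: finite_index_families)
  also have "\<dots> = (\<Sum>(m, \<kappa>)\<in>Sigma {2..Suc k} (\<lambda>m. index_families (k - (m - 1))). ?t (?add \<kappa> m) m)"
  proof (rule sum.reindex_bij_witness[of _ "\<lambda>(m, \<kappa>). (?add \<kappa> m, m)"
        "\<lambda>(\<kappa>, i). (i, \<kappa> - Poly_Mapping.single i 1)"], goal_cases)
    case (1 a)
    then show ?case by (auto simp: remove_add[unfolded One_nat_def])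
  next
    case (2 a)
    then obtain \<kappa> i where a: "a = (\<kappa>, i)" and \<kappa>: "\<kappa> \<in> index_families k" "i \<in> Poly_Mapping.keys \<kappa>"
      by auto
    let ?\<nu> = "\<kappa> - Poly_Mapping.single i 1"
    have "moment (\<lambda>i. i - 1) \<kappa> = moment (\<lambda>i. i - 1) ?\<nu> + (i - 1)"
      using moment_add_single[of "\<lambda>i. i - 1" ?\<nu> i] remove_add[OF \<kappa>(2)] by simp
    moreover have "Poly_Mapping.keys ?\<nu> \<subseteq> Poly_Mapping.keys \<kappa>"
      by (auto simp: in_keys_iff lookup_minus)
    ultimately show ?case
      using \<kappa> by (auto simp: a index_families_iff)
  next
    case (3 b)
    then show ?case by auto
  next
    case (4 b)
    then obtain m \<nu> where b: "b = (m, \<nu>)" and m: "m \<in> {2..Suc k}"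
      and \<nu>: "\<nu> \<in> index_families (k - (m - 1))"
      by auto
    have "moment (\<lambda>i. i - 1) (?add \<nu> m) = k"
      using \<nu> m unfolding moment_add_single by (auto simp: index_families_iff)
    moreover have "m \<in> Poly_Mapping.keys (?add \<nu> m)"
      by (simp add: in_keys_iff lookup_add)
    moreover have "Poly_Mapping.keys (?add \<nu> m) \<subseteq> {2..}"
      using keys_add[of \<nu> "Poly_Mapping.single m 1"] \<nu> m by (auto simp: index_families_iff)
    ultimately show ?case by (simp add: b index_families_iff)
  next
    case (5 a)
    then show ?case by (auto simp: remove_add[unfolded One_nat_def])
  qed
  also have "\<dots> = (\<Sum>m\<in>{2..Suc k}. \<Sum>\<kappa>\<in>index_families (k - (m - 1)). ?t (?add \<kappa> m) m)"
    by (rule sum.Sigma[symmetric]) (auto simp: finite_index_families)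
  also have "\<dots> = (\<Sum>m\<in>{2..Suc k}. smult (rat_const (1 / fact (m - 1)) * indet m)
       (back_shift 1 (falling_poly (m - 1)) * back_shift m (phi (k - (m - 1)))))"
  proof (rule sum.cong[OF refl])
    fix m assume m: "m \<in> {2..Suc k}"
    then have "back_shift 1 (falling_poly (moment id (?add \<kappa> m) - 1))
      = back_shift 1 (falling_poly (m - 1)) * back_shift m (falling_poly (moment id \<kappa>))" for \<kappa>
      using falling_poly_add[of "m - 1" "moment id \<kappa>"]
      by (simp add: moment_add_single[simplified] back_shift_mult back_shift_back_shift add.commute)
    moreover have "of_nat (m * Poly_Mapping.lookup (?add \<kappa> m) m) * weight (?add \<kappa> m)
      = rat_const (1 / fact (m - 1)) * indet m * weight \<kappa>" for \<kappa>
      using weight_add_single[of m \<kappa>] m by (simp add: lookup_add)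
    moreover have "smult a (sum g A) = (\<Sum>i\<in>A. smult a (g i))" for a and g :: "(nat \<Rightarrow>\<^sub>0 nat) \<Rightarrow> coeff_ring poly" and A
      by (induction A rule: infinite_finite_induct) (auto simp: smult_add_right)
    ultimately show "(\<Sum>\<kappa>\<in>index_families (k - (m - 1)). ?t (?add \<kappa> m) m)
      = smult (rat_const (1 / fact (m - 1)) * indet m)
       (back_shift 1 (falling_poly (m - 1)) * back_shift m (phi (k - (m - 1))))"
      by (simp only: phi_eq back_shift_sum back_shift_smult sum_distrib_left mult_smult_right smult_smult)
  qed
  finally show ?thesis .
qed

lemma index_families_0: "index_families 0 = {0}"
proof -
  have "\<kappa> = 0" if "\<kappa> \<in> index_families 0" for \<kappa>
  proof (rule ccontr)
    assume "\<kappa> \<noteq> 0"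
    then obtain i where i: "i \<in> Poly_Mapping.keys \<kappa>" by (auto simp: poly_mapping_eq_iff fun_eq_iff in_keys_iff)
    moreover from i that have "i \<ge> 2" "(i - 1) * Poly_Mapping.lookup \<kappa> i = 0"
      by (auto simp: index_families_def)
    ultimately show False by (auto simp: in_keys_iff)
  qed
  then show ?thesis by (auto simp: index_families_def)
qed

lemma phi_0: "phi 0 = 1"
  by (simp add: phi_eq index_families_0 weight_def moment_def)

lemma poly_phi_eq_0:
  assumes "n < k \<or> n = k \<and> k > 0"
  shows "poly (phi k) (of_nat n) = 0"
proof -
  have "poly (falling_poly (k + (\<Sum>i\<in>Poly_Mapping.keys \<kappa>. Poly_Mapping.lookup \<kappa> i))) (of_nat n :: coeff_ring) = 0"
    if "\<kappa> \<in> index_families k" for \<kappa>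
  proof (rule poly_falling_poly_eq_0)
    show "n < k + (\<Sum>i\<in>Poly_Mapping.keys \<kappa>. Poly_Mapping.lookup \<kappa> i)"
    proof (cases "n < k")
      case False
      with assms have "n = k" "k > 0" by auto
      with that have "Poly_Mapping.keys \<kappa> \<noteq> {}"
        by (auto simp: index_families_def)
      then have "(\<Sum>i\<in>Poly_Mapping.keys \<kappa>. Poly_Mapping.lookup \<kappa> i) > 0"
        by (intro sum_pos) (auto simp: in_keys_iff)
      with \<open>n = k\<close> show ?thesis by simp
    qed simp
  qed
  then show ?thesis
    by (auto simp: phi_def poly_sum intro!: sum.neutral)
qed

definition rec_coeff :: "nat \<Rightarrow> coeff_ring poly" where
  "rec_coeff j = smult (fps_deriv f_series $ j) (back_shift 1 (falling_poly j))"

lemma phi_rec: "phi k = (\<Sum>j\<le>k. rec_coeff j * back_shift (Suc j) (phi (k - j)))"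
proof -
  have "(\<Sum>j\<le>k. rec_coeff j * back_shift (Suc j) (phi (k - j)))
    = back_shift 1 (phi k) + (\<Sum>j\<in>{1..k}. rec_coeff j * back_shift (Suc j) (phi (k - j)))"
    unfolding atMost_atLeast0
    by (subst sum.atLeast_Suc_atMost)
      (auto simp: rec_coeff_def fps_deriv_f_series_nth simp del: fps_deriv_nth)
  also have "(\<Sum>j\<in>{1..k}. rec_coeff j * back_shift (Suc j) (phi (k - j)))
    = phi k - back_shift 1 (phi k)"
    unfolding phi_minus_back_shift
    by (rule sum.reindex_bij_witness[of _ "\<lambda>m. m - 1" Suc])
      (auto simp: rec_coeff_def fps_deriv_f_series_nth simp del: fps_deriv_nth)
  finally show ?thesis by simp
qed

lemma poly_phi_Suc:
  assumes "k \<le> N"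
  shows "rat_const (1 / fact N) * poly (phi k) (of_nat (Suc N))
    = (\<Sum>j\<le>k. fps_deriv f_series $ j * (rat_const (1 / fact (N - j)) * poly (phi (k - j)) (of_nat (N - j))))"
proof -
  have "poly (phi k) (of_nat (Suc N)) = (\<Sum>j\<le>k. fps_deriv f_series $ j *
      (poly (falling_poly j) (of_nat N) * poly (phi (k - j)) (of_nat (N - j))))"
    by (subst phi_rec)
      (use assms in \<open>simp add: poly_sum rec_coeff_def poly_back_shift of_nat_diff mult.assoc del: fps_deriv_nth\<close>)
  also have "rat_const (1 / fact N) * \<dots> = (\<Sum>j\<le>k. fps_deriv f_series $ j *
      (rat_const (1 / fact N) * poly (falling_poly j) (of_nat N) * poly (phi (k - j)) (of_nat (N - j))))"
    by (simp add: sum_distrib_left mult_ac del: fps_deriv_nth)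
  also have "\<dots> = (\<Sum>j\<le>k. fps_deriv f_series $ j * (rat_const (1 / fact (N - j)) * poly (phi (k - j)) (of_nat (N - j))))"
    using assms by (intro sum.cong refl) (simp add: poly_falling_poly del: fps_deriv_nth)
  finally show ?thesis .
qed

lemma F_poly_0: "F_poly 0 = 1"
  by (simp add: F_poly_def)

lemma F_poly_Suc:
  "of_nat (Suc n) * F_poly (Suc n) = (\<Sum>j\<le>n. pCons 0 (smult (fps_deriv f_series $ j) (F_poly (n - j))))"
proof -
  have "of_nat (Suc n) * F_poly (Suc n) = fps_deriv (formal_exp (poly_var * lift_const f_series)) $ n"
    by (simp add: F_poly_def)
  also have "\<dots> = (fps_deriv (poly_var * lift_const f_series) * formal_exp (poly_var * lift_const f_series)) $ n"
    by (subst fps_deriv_formal_exp) (simp_all add: poly_var_def f_series_def)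
  also have "\<dots> = (\<Sum>j\<le>n. pCons 0 (smult (fps_deriv f_series $ j) (F_poly (n - j))))"
    unfolding fps_mult_nth atMost_atLeast0
    by (intro sum.cong refl)
      (simp add: poly_var_def F_poly_def of_nat_mult_conv_smult mult.commute del: of_nat_Suc)
  finally show ?thesis .
qed

lemma coeff_F_poly:
  "coeff (F_poly n) d
    = (if d \<le> n then rat_const (1 / fact n) * poly (phi (n - d)) (of_nat n) else 0)"
proof (induction n arbitrary: d rule: less_induct)
  case (less n)
  show ?case
  proof (cases n)
    case 0
    then show ?thesis by (simp add: F_poly_0 phi_0)
  next
    case (Suc N)
    have rec: "of_nat n * coeff (F_poly n) d
      = (\<Sum>j\<le>N. coeff (pCons 0 (smult (fps_deriv f_series $ j) (F_poly (N - j)))) d)"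
      unfolding Suc coeff_of_nat_mult[symmetric] F_poly_Suc coeff_sum ..
    have "of_nat n * coeff (F_poly n) d
      = of_nat n * (if d \<le> n then rat_const (1 / fact n) * poly (phi (n - d)) (of_nat n) else 0)"
    proof (cases d)
      case 0
      have "poly (phi n) (of_nat n) = 0"
        using Suc by (intro poly_phi_eq_0) auto
      with 0 show ?thesis unfolding rec by simp
    next
      case (Suc e)
      have "of_nat n * coeff (F_poly n) d = (\<Sum>j\<le>N. fps_deriv f_series $ j * coeff (F_poly (N - j)) e)"
        unfolding rec by (simp add: Suc del: fps_deriv_nth)
      also have "\<dots> = (\<Sum>j\<le>N. fps_deriv f_series $ j * (if e \<le> N - j
          then rat_const (1 / fact (N - j)) * poly (phi (N - j - e)) (of_nat (N - j)) else 0))"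
        using \<open>n = Suc N\<close> by (intro sum.cong refl) (simp add: less del: fps_deriv_nth)
      also have "\<dots> = (if e \<le> N then rat_const (1 / fact N) * poly (phi (N - e)) (of_nat n) else 0)"
      proof (cases "e \<le> N")
        case True
        have "(\<Sum>j\<le>N. fps_deriv f_series $ j * (if e \<le> N - j
            then rat_const (1 / fact (N - j)) * poly (phi (N - j - e)) (of_nat (N - j)) else 0))
          = (\<Sum>j\<le>N - e. fps_deriv f_series $ j * (if e \<le> N - j
            then rat_const (1 / fact (N - j)) * poly (phi (N - j - e)) (of_nat (N - j)) else 0))"
          using True by (intro sum.mono_neutral_right) auto
        also have "\<dots> = (\<Sum>j\<le>N - e. fps_deriv f_series $ j *
            (rat_const (1 / fact (N - j)) * poly (phi (N - e - j)) (of_nat (N - j))))"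
          using True by (intro sum.cong refl) (auto simp: add.commute simp del: fps_deriv_nth)
        finally show ?thesis
          using True poly_phi_Suc[of "N - e" N] by (simp only: \<open>n = Suc N\<close> if_True diff_le_self)
      qed (auto intro!: sum.neutral)
      also have "rat_const (1 / fact N) = of_nat n * rat_const (1 / fact n)"
        unfolding of_nat_mult_rat_const \<open>n = Suc N\<close>
        by (intro arg_cong[of _ _ rat_const]) (simp add: divide_simps del: of_nat_Suc)
      finally show ?thesis by (simp add: Suc \<open>n = Suc N\<close> mult.assoc del: of_nat_Suc)
    qed
    then show ?thesis using Suc by (simp del: of_nat_Suc)
  qed
qed

lemma F_poly_eq:
  "F_poly n = (\<Sum>k\<le>n. monom (rat_const (1 / fact n) * poly (phi k) (of_nat n)) (n - k))"
proof -
  have "degree (F_poly n) \<le> n"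
    by (intro degree_le) (simp add: coeff_F_poly)
  then have "F_poly n = (\<Sum>d\<le>n. monom (coeff (F_poly n) d) d)"
    by (rule poly_as_sum_of_monoms'[symmetric])
  also have "\<dots> = (\<Sum>k\<le>n. monom (rat_const (1 / fact n) * poly (phi k) (of_nat n)) (n - k))"
    by (rule sum.reindex_bij_witness[of _ "\<lambda>k. n - k" "\<lambda>d. n - d"]) (auto simp: coeff_F_poly)
  finally show ?thesis .
qed

section \<open>The ratio\<close>

definition rec_kernel :: "nat \<Rightarrow> coeff_ring poly fps" where
  "rec_kernel j = fps_const (rec_coeff j) * fps_X ^ j * shift_quotient (Suc j)"

lemma F_ratio_rec:
  "F_ratio $ k = (\<Sum>j\<le>k. rec_kernel j * map_fps (back_shift (Suc j)) F_ratio) $ k"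
proof -
  let ?T = F_tilde_factor
  let ?S = "\<Sum>j\<le>k. rec_kernel j * map_fps (back_shift (Suc j)) F_ratio"
  have inv: "?T * fps_right_inverse ?T 1 = 1"
    by (rule fps_right_inverse) (simp add: F_tilde_factor_eq_formal_exp)
  have factor: "fps_const (rec_coeff j) * fps_X ^ j * map_fps (back_shift (Suc j)) F_factor
      = ?T * (rec_kernel j * map_fps (back_shift (Suc j)) F_ratio)" for j
    unfolding F_ratio_times_F_tilde_factor[symmetric] fps_back_shift_mult
      fps_back_shift_F_tilde_factor rec_kernel_def
    by (simp only: mult_ac)
  have "F_factor $ l = (?T * ?S) $ l" if "l \<le> k" for l
  proof -
    have "F_factor $ l = (\<Sum>j\<le>l. rec_coeff j * back_shift (Suc j) (phi (l - j)))"
      unfolding F_factor_def by (simp add: phi_rec[symmetric])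
    also have "\<dots> = (\<Sum>j\<le>k. (fps_const (rec_coeff j) * fps_X ^ j * map_fps (back_shift (Suc j)) F_factor) $ l)"
      using that by (intro sum.mono_neutral_cong_left)
        (auto simp: mult.assoc fps_X_power_mult_nth F_factor_def)
    also have "\<dots> = (?T * ?S) $ l"
      unfolding factor by (simp add: sum_distrib_left fps_sum_nth)
    finally show ?thesis .
  qed
  then have "F_ratio $ k = (?T * ?S * fps_right_inverse ?T 1) $ k"
    unfolding F_ratio_def by (auto simp: fps_mult_nth[of _ "fps_right_inverse ?T 1"] intro!: sum.cong)
  also have "?T * ?S * fps_right_inverse ?T 1 = ?S * (?T * fps_right_inverse ?T 1)"
    by (simp only: mult_ac)
  finally show ?thesis
    by (simp only: inv mult_1_right)
qed

lemma diag_bounded_const_X_power: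
  assumes "degree a \<le> j"
  shows "diag_bounded (fps_const a * fps_X ^ j)"
  using assms by (simp add: diag_bounded_def fps_X_power_nth)

lemma diag_const_X_power: "diag (fps_const a * fps_X ^ j) = fps_const (coeff a j) * fps_X ^ j"
  by (rule fps_ext) (simp add: fps_X_power_nth)

lemma degree_rec_coeff: "degree (rec_coeff j) \<le> j"
  unfolding rec_coeff_def
  by (intro order.trans[OF degree_smult_le] coeff_back_shift degree_falling_poly)

lemma lead_coeff_rec_coeff: "coeff (rec_coeff j) j = fps_deriv f_series $ j"
  by (simp add: rec_coeff_def coeff_back_shift degree_falling_poly lead_coeff_falling_poly del: fps_deriv_nth)

lemma diag_bounded_rec_kernel: "diag_bounded (rec_kernel j)"
  unfolding rec_kernel_def
  by (intro diag_bounded_mult diag_bounded_const_X_power diag_bounded_shift_quotient degree_rec_coeff)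

lemma diag_rec_kernel:
  "diag (rec_kernel j) = fps_const (fps_deriv f_series $ j) * fps_X ^ j * s_over_y ^ Suc j"
  unfolding rec_kernel_def
  by (subst diag_mult)
    (simp_all only: diag_bounded_const_X_power diag_bounded_shift_quotient degree_rec_coeff
      diag_const_X_power lead_coeff_rec_coeff diag_shift_quotient)

lemma rec_kernel_nth_0: "rec_kernel j $ 0 = (if j = 0 then 1 else 0)"
  by (simp add: rec_kernel_def rec_coeff_def fps_deriv_f_series_nth shift_quotient_def fps_X_power_nth
      del: fps_deriv_nth)

lemma sum_diag_rec_kernel:
  assumes "0 < i" "i \<le> k"
  shows "(\<Sum>j\<le>k. diag (rec_kernel j) $ i) = 0"
proof -
  have "(\<Sum>j\<le>k. diag (rec_kernel j) $ i)
    = (\<Sum>j\<le>i. fps_deriv f_series $ j * (s_over_y ^ Suc j) $ (i - j))"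
    unfolding diag_rec_kernel mult.assoc fps_mult_left_const_nth fps_X_power_mult_nth
    using assms by (intro sum.mono_neutral_cong_right) auto
  also have "\<dots> = (s_over_y * (fps_deriv f_series oo s_series)) $ i"
    unfolding s_series_eq_X_mult fps_mult_compose_X_mult_nth ..
  finally show ?thesis
    using assms by (simp add: s_over_y_eq)
qed

lemma diag_bounded_F_ratio: "diag_bounded F_ratio"
  unfolding diag_bounded_def
proof
  fix k
  show "degree (F_ratio $ k) \<le> k"
  proof (induction k rule: less_induct)
    case (less k)
    let ?R = "F_ratio"
    let ?t = "\<lambda>i j. back_shift (Suc j) (?R $ i) * rec_kernel j $ (k - i)"
    have "?R $ k = (\<Sum>j\<le>k. \<Sum>i\<le>k. ?t i j)"
      by (subst F_ratio_rec)
        (simp add: fps_sum_nth fps_mult_nth mult.commute[of "rec_kernel _"] atMost_atLeast0)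
    also have "\<dots> = (\<Sum>i\<le>k. \<Sum>j\<le>k. ?t i j)"
      by (rule sum.swap)
    also have "\<dots> = (\<Sum>i<k. \<Sum>j\<le>k. ?t i j) + (\<Sum>j\<le>k. ?t k j)"
      by (simp add: lessThan_Suc_atMost[symmetric])
    also have "(\<Sum>j\<le>k. ?t k j) = back_shift 1 (?R $ k)"
      by (simp add: rec_kernel_nth_0 if_distrib[of "\<lambda>x. _ * x"] sum.delta cong: if_cong)
    finally have eq: "?R $ k - back_shift 1 (?R $ k) = (\<Sum>i<k. \<Sum>j\<le>k. ?t i j)"
      by (simp add: algebra_simps)
    have bounds: "degree (back_shift (Suc j) (?R $ i)) \<le> i" "degree (rec_kernel j $ (k - i)) \<le> k - i"
      if "i < k" for i j
      using coeff_back_shift(1)[OF less[OF that]] diag_bounded_rec_kernel by (auto simp: diag_bounded_def)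
    show "degree (?R $ k) \<le> k"
    proof (rule degree_le_if_back_shift_diff)
      have "degree (?t i j) \<le> k" if "i < k" for i j
        using order.trans[OF degree_mult_le add_mono[OF bounds[OF that]]] that by simp
      then show "degree (?R $ k - back_shift 1 (?R $ k)) \<le> k"
        unfolding eq by (intro degree_sum_le) auto
      have "coeff (?t i j) k = coeff (?R $ i) i * diag (rec_kernel j) $ (k - i)" if "i < k" for i j
        using coeff_mult_add_degree_le[OF bounds[OF that]] that less[OF that]
        by (simp add: coeff_back_shift(2))
      then have "coeff (?R $ k - back_shift 1 (?R $ k)) k
        = (\<Sum>i<k. \<Sum>j\<le>k. coeff (?R $ i) i * diag (rec_kernel j) $ (k - i))"
        unfolding eq coeff_sum by (intro sum.cong refl) auto
      also have "\<dots> = (\<Sum>i<k. coeff (?R $ i) i * (\<Sum>j\<le>k. diag (rec_kernel j) $ (k - i)))"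
        by (simp only: sum_distrib_left)
      also have "\<dots> = 0"
        by (intro sum.neutral ballI) (simp add: sum_diag_rec_kernel del: diag_nth)
      finally show "coeff (?R $ k - back_shift 1 (?R $ k)) k = 0" .
    qed
  qed
qed

lemma diag_bounded_expansion:
  assumes "diag_bounded g"
  shows "(\<lambda>N. \<Sum>i\<le>N. \<Sum>j\<le>N. fps_const [:coeff (g $ (i + j)) i:] * y_series ^ i * fps_X ^ j) \<longlonglongrightarrow> g"
proof (rule tendsto_fpsI)
  fix k
  have nth: "(fps_const [:a:] * y_series ^ i * fps_X ^ j) $ k = (if k = i + j then monom a i else 0)"
    for a i j
    by (simp add: y_series_def poly_var_def power_mult_distrib fps_const_power mult.assoc
        fps_X_power_nth monom_altdef flip: power_add)
  have "(\<Sum>i\<le>N. \<Sum>j\<le>N. fps_const [:coeff (g $ (i + j)) i:] * y_series ^ i * fps_X ^ j) $ k = g $ k"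
    if "k \<le> N" for N
  proof -
    have "(\<Sum>j\<le>N. if k = i + j then monom (coeff (g $ (i + j)) i) i else 0)
      = (if i \<le> k then monom (coeff (g $ k) i) i else 0)" for i
    proof -
      have "(\<Sum>j\<le>N. if k = i + j then monom (coeff (g $ (i + j)) i) i else 0)
        = (\<Sum>j\<le>N. if j = k - i then if i \<le> k then monom (coeff (g $ k) i) i else 0 else 0)"
        by (intro sum.cong) auto
      moreover have "k - i \<le> N"
        using that by simp
      ultimately show ?thesis by simp
    qed
    then have "(\<Sum>i\<le>N. \<Sum>j\<le>N. fps_const [:coeff (g $ (i + j)) i:] * y_series ^ i * fps_X ^ j) $ k
      = (\<Sum>i\<le>N. if i \<le> k then monom (coeff (g $ k) i) i else 0)"
      by (simp only: fps_sum_nth nth)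
    also have "\<dots> = (\<Sum>i\<le>k. monom (coeff (g $ k) i) i)"
      using that by (intro sum.mono_neutral_cong_right) auto
    also have "\<dots> = g $ k"
      using assms by (intro poly_as_sum_of_monoms') (simp add: diag_bounded_def)
    finally show ?thesis .
  qed
  then show "\<forall>\<^sub>F N in sequentially. (\<Sum>i\<le>N. \<Sum>j\<le>N. fps_const [:coeff (g $ (i + j)) i:] * y_series ^ i * fps_X ^ j) $ k = g $ k"
    by (intro eventually_sequentiallyI)
qed

theorem mainTheorem1:
  shows "(\<forall>n. F_poly n = (\<Sum>k\<le>n. monom (rat_const (1 / fact n) * poly (phi k) (of_nat n)) (n - k))
            \<and> (\<forall>k>n. poly (phi k) (of_nat n) = 0))
       \<and> (\<exists>c :: nat \<Rightarrow> nat \<Rightarrow> coeff_ring.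
            (\<lambda>N. \<Sum>i\<le>N. \<Sum>j\<le>N. fps_const [:c i j:] * y_series ^ i * fps_X ^ j) \<longlonglongrightarrow> F_ratio
            \<and> (\<forall>i j. c i j = coeff (F_ratio $ (i + j)) i))
       \<and> (\<forall>i j. i > j \<longrightarrow> coeff (F_ratio $ j) i = 0)"
proof (intro conjI allI impI exI)
  show "coeff (F_ratio $ j) i = 0" if "i > j" for i j
    using that diag_bounded_F_ratio coeff_eq_0 le_less_trans unfolding diag_bounded_def by blast
qed (use F_poly_eq poly_phi_eq_0 diag_bounded_expansion[OF diag_bounded_F_ratio] in auto)

end
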